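(* Let $f\colon A\to B$ be a surjective homomorphism of skew braces (an extension). The following are equivalent: (i) $f$ is a central extension with respect to the subvariety $\mathsf{RadRng}$ of radical rings of the variety $\mathsf{SKB}$ of skew braces; (ii) $\operatorname{Ker}(f)\subset Z_R(A)$; (iii) $[\operatorname{Ker}(f),A]_{\mathsf{RadRng}}=0$.
   Context: A skew brace is a triple $(A,+,\circ)$ where $(A,+)$ and $(A,\circ)$ are groups such that $a\circ(b+c)=a\circ b-a+a\circ c$ for all $a,b,c\in A$; the common identity is $0$. Put $a*b=-a+a\circ b-b$. An ideal of $A$ is a normal subgroup $I$ of $(A,+)$ with $a*x, x*a\in I$ for all $a\in A$, $x\in I$. Write $Z(A_+)$ for the center of $A_+=(A,+)$. The right distributor of $a,b,c\in A$ is $[a,b,c]=(a+b)\circ c-b\circ c+c-a\circ c$. For an ideal $I$ of $A$, $[I,A]_{\mathsf{RadRng}}$ is the subgroup of $(A,+)$ generated by the elements $[a,b,c]$, $[c,a,b]$, $[b,c,a]$ and $a+b-a-b$ for all $a\in I$ and $b,c\in A$. Put $$Z_R(A)=\{z\in Z(A_+) : [z,b,c]=[b,z,c]=[b,c,z]=0\ \text{for all } b,c\in A\}.$$ $\mathsf{RadRng}$ is (identified with) the full subcategory of $\mathsf{SKB}$ consisting of the skew braces satisfying the identities $(a+b)\circ c=a\circ c-c+b\circ c$ and $a+b=b+a$. The inclusion $\mathsf{RadRng}\to\mathsf{SKB}$ has a left adjoint, sending $A$ to $A/R(A)$, where $R(A)=[A,A]_{\mathsf{RadRng}}$ is an ideal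 of $A$, the kernel of the unit of the adjunction; $R$ is an endofunctor of $\mathsf{SKB}$, acting on morphisms by restriction. For an extension $f\colon A\to B$, let $A\times_B A=\{(a_1,a_2)\in A\times A\mid f(a_1)=f(a_2)\}$ with first and second projections $s,t\colon A\times_B A\to A$. The extension is central with respect to $\mathsf{RadRng}$ if $R(s)=R(t)$, i.e. $s$ and $t$ agree on $R(A\times_B A)$. *)

theory Defs
  imports "HOL-Algebra.Algebra"
begin

text \<open>
  A skew brace is carried by the two-operation record of HOL-Algebra: \<open>\<oplus>\<close> is the
  (possibly non-commutative) addition \<open>+\<close>, with identity \<open>\<zero>\<close> and inverse \<open>\<ominus>\<close>, and \<open>\<otimes>\<close> is
  the circle operation \<open>\<circ>\<close>, with identity \<open>\<one>\<close>. No ring axioms are assumed; that the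
  two identities coincide is a consequence of the axioms (lemma \<open>one_eq_zero\<close>).
  Since \<open>+\<close> need not commute, note that \<open>\<oplus>\<close> and \<open>\<ominus>\<close> associate to the left.
\<close>

locale skew_brace =
  fixes A (structure)
  assumes add_group: "group (add_monoid A)"
    and circ_group: "group A"
    and brace_law: "\<lbrakk>a \<in> carrier A; b \<in> carrier A; c \<in> carrier A\<rbrakk>
      \<Longrightarrow> a \<otimes> (b \<oplus> c) = a \<otimes> b \<ominus> a \<oplus> a \<otimes> c"

definition skew_brace_hom ::
    "('a, 'm) ring_scheme \<Rightarrow> ('b, 'n) ring_scheme \<Rightarrow> ('a \<Rightarrow> 'b) set"
  where "skew_brace_hom A B = hom (add_monoid A) (add_monoid B) \<inter> hom A B"

definition skew_brace_extension ::
    "('a, 'm) ring_scheme \<Rightarrow> ('b, 'n) ring_scheme \<Rightarrow> ('a \<Rightarrow> 'b) \<Rightarrow> bool"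
  where "skew_brace_extension A B f \<longleftrightarrow>
    skew_brace A \<and> skew_brace B \<and> f \<in> skew_brace_hom A B \<and> f ` carrier A = carrier B"

definition in_RadRng :: "('a, 'm) ring_scheme \<Rightarrow> bool"
  where "in_RadRng A \<longleftrightarrow> skew_brace A \<and>
    (\<forall>a\<in>carrier A. \<forall>b\<in>carrier A. \<forall>c\<in>carrier A.
      (a \<oplus>\<^bsub>A\<^esub> b) \<otimes>\<^bsub>A\<^esub> c = a \<otimes>\<^bsub>A\<^esub> c \<ominus>\<^bsub>A\<^esub> c \<oplus>\<^bsub>A\<^esub> b \<otimes>\<^bsub>A\<^esub> c) \<and>
    (\<forall>a\<in>carrier A. \<forall>b\<in>carrier A. a \<oplus>\<^bsub>A\<^esub> b = b \<oplus>\<^bsub>A\<^esub> a)"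

definition right_distributor :: "('a, 'm) ring_scheme \<Rightarrow> 'a \<Rightarrow> 'a \<Rightarrow> 'a \<Rightarrow> 'a"
  where "right_distributor A a b c =
    (a \<oplus>\<^bsub>A\<^esub> b) \<otimes>\<^bsub>A\<^esub> c \<ominus>\<^bsub>A\<^esub> b \<otimes>\<^bsub>A\<^esub> c \<oplus>\<^bsub>A\<^esub> c \<ominus>\<^bsub>A\<^esub> a \<otimes>\<^bsub>A\<^esub> c"

text \<open>\<open>[I, A]\<close> relative to \<open>RadRng\<close>, a subgroup of the additive group.\<close>

definition RadRng_commutator :: "('a, 'm) ring_scheme \<Rightarrow> 'a set \<Rightarrow> 'a set"
  where "RadRng_commutator A I = generate (add_monoid A)
    (\<Union>a\<in>I. \<Union>b\<in>carrier A. \<Union>c\<in>carrier A.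
      {right_distributor A a b c, right_distributor A c a b, right_distributor A b c a,
       a \<oplus>\<^bsub>A\<^esub> b \<ominus>\<^bsub>A\<^esub> a \<ominus>\<^bsub>A\<^esub> b})"

definition additive_center :: "('a, 'm) ring_scheme \<Rightarrow> 'a set"
  where "additive_center A =
    {z \<in> carrier A. \<forall>a\<in>carrier A. z \<oplus>\<^bsub>A\<^esub> a = a \<oplus>\<^bsub>A\<^esub> z}"

definition Z_R :: "('a, 'm) ring_scheme \<Rightarrow> 'a set"
  where "Z_R A = {z \<in> additive_center A. \<forall>b\<in>carrier A. \<forall>c\<in>carrier A.
    right_distributor A z b c = \<zero>\<^bsub>A\<^esub> \<and>
    right_distributor A b z c = \<zero>\<^bsub>A\<^esub> \<and>
    right_distributor A b c z = \<zero>\<^bsub>A\<^esub>}"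

text \<open>
  The kernel functor \<open>R\<close> of the reflection of skew braces onto \<open>RadRng\<close>: on objects
  \<open>R(A) = [A, A]\<close> relative to \<open>RadRng\<close>, on morphisms (out of \<open>A\<close>) restriction to \<open>R(A)\<close>.
\<close>

definition R_obj :: "('a, 'm) ring_scheme \<Rightarrow> 'a set"
  where "R_obj A = RadRng_commutator A (carrier A)"

definition R_mor :: "('a, 'm) ring_scheme \<Rightarrow> ('a \<Rightarrow> 'b) \<Rightarrow> 'a \<Rightarrow> 'b"
  where "R_mor A h = restrict h (R_obj A)"

definition kernel_pair :: "('a, 'm) ring_scheme \<Rightarrow> ('a \<Rightarrow> 'b) \<Rightarrow> ('a \<times> 'a) ring"
  where "kernel_pair A f = (RDirProd A A)
    \<lparr>carrier := {(a1, a2). a1 \<in> carrier A \<and> a2 \<in> carrier A \<and> f a1 = f a2}\<rparr>"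

definition RadRng_central ::
    "('a, 'm) ring_scheme \<Rightarrow> ('b, 'n) ring_scheme \<Rightarrow> ('a \<Rightarrow> 'b) \<Rightarrow> bool"
  where "RadRng_central A B f \<longleftrightarrow> skew_brace_extension A B f \<and>
    R_mor (kernel_pair A f) fst = R_mor (kernel_pair A f) snd"

text \<open>Consistency checks of the encoding.\<close>

lemma (in skew_brace) one_eq_zero: "\<one> = \<zero>"
proof -
  interpret P: group "add_monoid A" by (rule add_group)
  interpret C: group A by (rule circ_group)
  have z: "\<zero> \<in> carrier A" using P.one_closed by simp
  have "\<one> \<otimes> (\<zero> \<oplus> \<one>) = \<one> \<otimes> \<zero> \<ominus> \<one> \<oplus> \<one> \<otimes> \<one>"
    using z by (intro brace_law) auto
  then have "\<one> = \<zero> \<ominus> \<one> \<oplus> \<one>" using z P.l_one[of \<one>] by simp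
  moreover have "\<zero> \<ominus> \<one> \<oplus> \<one> = \<zero>"
    using P.l_inv[of \<one>] P.l_one[of "\<ominus> \<one>"] P.inv_closed[of \<one>]
    by (simp add: a_minus_def a_inv_def)
  ultimately show ?thesis by simp
qed

lemma kernel_pair_skew_brace:
  assumes "skew_brace_extension A B f"
  shows "skew_brace (kernel_pair A f)"
    and "fst \<in> skew_brace_hom (kernel_pair A f) A"
    and "snd \<in> skew_brace_hom (kernel_pair A f) A"
proof -
  interpret A: skew_brace A using assms by (simp add: skew_brace_extension_def)
  interpret B: skew_brace B using assms by (simp add: skew_brace_extension_def)
  interpret P: group "add_monoid A" by (rule A.add_group)
  interpret C: group A by (rule A.circ_group)
  have fp: "f \<in> hom (add_monoid A) (add_monoid B)" and fc: "f \<in> hom A B"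
    using assms by (auto simp: skew_brace_extension_def skew_brace_hom_def)
  interpret FP: group_hom "add_monoid A" "add_monoid B" f
    by (simp add: group_hom_def group_hom_axioms_def A.add_group B.add_group fp)
  interpret FC: group_hom A B f
    by (simp add: group_hom_def group_hom_axioms_def A.circ_group B.circ_group fc)
  let ?K = "kernel_pair A f"
  have carr: "x \<in> carrier ?K \<longleftrightarrow> fst x \<in> carrier A \<and> snd x \<in> carrier A \<and> f (fst x) = f (snd x)" for x
    by (cases x) (auto simp: kernel_pair_def)
  have ops: "x \<oplus>\<^bsub>?K\<^esub> y = (fst x \<oplus>\<^bsub>A\<^esub> fst y, snd x \<oplus>\<^bsub>A\<^esub> snd y)"
    "x \<otimes>\<^bsub>?K\<^esub> y = (fst x \<otimes>\<^bsub>A\<^esub> fst y, snd x \<otimes>\<^bsub>A\<^esub> snd y)"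
    "\<zero>\<^bsub>?K\<^esub> = (\<zero>\<^bsub>A\<^esub>, \<zero>\<^bsub>A\<^esub>)" "\<one>\<^bsub>?K\<^esub> = (\<one>\<^bsub>A\<^esub>, \<one>\<^bsub>A\<^esub>)" for x y
    by (cases x; cases y; auto simp: kernel_pair_def RDirProd_def monoid.defs DirProd_def)+
  have addK: "group (add_monoid ?K)"
  proof (rule groupI)
    fix x assume "x \<in> carrier (add_monoid ?K)"
    then show "\<exists>y\<in>carrier (add_monoid ?K). y \<otimes>\<^bsub>add_monoid ?K\<^esub> x = \<one>\<^bsub>add_monoid ?K\<^esub>"
      using P.inv_closed P.l_inv FP.hom_inv
      by (intro bexI[of _ "(\<ominus>\<^bsub>A\<^esub> fst x, \<ominus>\<^bsub>A\<^esub> snd x)"])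
        (auto simp: carr ops a_inv_def)
  qed (use P.m_closed P.m_assoc P.l_one P.one_closed FP.hom_mult in \<open>auto simp: carr ops\<close>)
  have circK: "group ?K"
  proof (rule groupI)
    fix x assume "x \<in> carrier ?K"
    then show "\<exists>y\<in>carrier ?K. y \<otimes>\<^bsub>?K\<^esub> x = \<one>\<^bsub>?K\<^esub>"
      by (intro bexI[of _ "(inv\<^bsub>A\<^esub> fst x, inv\<^bsub>A\<^esub> snd x)"]) (auto simp: carr ops)
  qed (auto simp: carr ops C.m_assoc)
  interpret K: group "add_monoid ?K" by (rule addK)
  have negK: "\<ominus>\<^bsub>?K\<^esub> x = (\<ominus>\<^bsub>A\<^esub> fst x, \<ominus>\<^bsub>A\<^esub> snd x)" if "x \<in> carrier ?K" for x
    unfolding a_inv_def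
    by (rule K.inv_equality)
      (use that P.inv_closed P.l_inv FP.hom_inv in \<open>auto simp: carr ops\<close>)
  show "skew_brace ?K"
  proof (rule skew_brace.intro)
    fix a b c assume abc: "a \<in> carrier ?K" "b \<in> carrier ?K" "c \<in> carrier ?K"
    then show "a \<otimes>\<^bsub>?K\<^esub> (b \<oplus>\<^bsub>?K\<^esub> c) = a \<otimes>\<^bsub>?K\<^esub> b \<ominus>\<^bsub>?K\<^esub> a \<oplus>\<^bsub>?K\<^esub> a \<otimes>\<^bsub>?K\<^esub> c"
      using A.brace_law[of "fst a" "fst b" "fst c"] A.brace_law[of "snd a" "snd b" "snd c"]
        negK[OF abc(1)]
      by (simp add: carr ops a_minus_def)
  qed (rule addK circK)+
  show "fst \<in> skew_brace_hom ?K A" "snd \<in> skew_brace_hom ?K A"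
    by (auto simp: skew_brace_hom_def hom_def carr ops)
qed

lemma in_RadRng_iff:
  assumes "skew_brace A"
  shows "in_RadRng A \<longleftrightarrow> R_obj A = {\<zero>\<^bsub>A\<^esub>}"
proof -
  interpret A: skew_brace A by (rule assms)
  interpret P: group "add_monoid A" by (rule A.add_group)
  interpret C: group A by (rule A.circ_group)
  have add: "x \<oplus>\<^bsub>A\<^esub> y \<in> carrier A" if "x \<in> carrier A" "y \<in> carrier A" for x y
    using P.m_closed that by simp
  have neg: "\<ominus>\<^bsub>A\<^esub> x \<in> carrier A" if "x \<in> carrier A" for x
    using P.inv_closed that by (simp add: a_inv_def)
  have zero: "\<zero>\<^bsub>A\<^esub> \<in> carrier A" using P.one_closed by simp
  have minus_zero: "x \<ominus>\<^bsub>A\<^esub> y = \<zero>\<^bsub>A\<^esub> \<longleftrightarrow> x = y" if "x \<in> carrier A" "y \<in> carrier A" for x y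
    using P.inv_solve_right'[of "\<zero>\<^bsub>A\<^esub>" x y] P.l_one that zero
    by (auto simp: a_minus_def a_inv_def)
  have minus_eq: "x \<ominus>\<^bsub>A\<^esub> y = z \<longleftrightarrow> x = z \<oplus>\<^bsub>A\<^esub> y"
    if "x \<in> carrier A" "y \<in> carrier A" "z \<in> carrier A" for x y z
    using P.inv_solve_right'[of z x y] that by (auto simp: a_minus_def a_inv_def)
  have minus: "x \<ominus>\<^bsub>A\<^esub> y \<in> carrier A" if "x \<in> carrier A" "y \<in> carrier A" for x y
    using add neg that by (simp add: a_minus_def)
  let ?S = "\<Union>a\<in>carrier A. \<Union>b\<in>carrier A. \<Union>c\<in>carrier A.
      {right_distributor A a b c, right_distributor A c a b, right_distributor A b c a,
       a \<oplus>\<^bsub>A\<^esub> b \<ominus>\<^bsub>A\<^esub> a \<ominus>\<^bsub>A\<^esub> b}"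
  have R: "R_obj A = {\<zero>\<^bsub>A\<^esub>} \<longleftrightarrow> ?S \<subseteq> {\<zero>\<^bsub>A\<^esub>}"
  proof
    assume "R_obj A = {\<zero>\<^bsub>A\<^esub>}"
    then show "?S \<subseteq> {\<zero>\<^bsub>A\<^esub>}"
      unfolding R_obj_def RadRng_commutator_def using generate.incl[of _ ?S "add_monoid A"] by blast
  next
    assume S: "?S \<subseteq> {\<zero>\<^bsub>A\<^esub>}"
    have "generate (add_monoid A) ?S \<subseteq> {\<zero>\<^bsub>A\<^esub>}"
      using P.generate_subgroup_incl[OF S] P.triv_subgroup by simp
    then show "R_obj A = {\<zero>\<^bsub>A\<^esub>}"
      unfolding R_obj_def RadRng_commutator_def using generate.one[of "add_monoid A" ?S] by auto
  qed
  have comm: "a \<oplus>\<^bsub>A\<^esub> b \<ominus>\<^bsub>A\<^esub> a \<ominus>\<^bsub>A\<^esub> b = \<zero>\<^bsub>A\<^esub> \<longleftrightarrow> a \<oplus>\<^bsub>A\<^esub> b = b \<oplus>\<^bsub>A\<^esub> a"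
    if "a \<in> carrier A" "b \<in> carrier A" for a b
    using minus_zero[OF minus[OF add[OF that] that(1)] that(2)] minus_eq[OF add[OF that] that] by simp
  have dist: "right_distributor A a b c = \<zero>\<^bsub>A\<^esub> \<longleftrightarrow>
      (a \<oplus>\<^bsub>A\<^esub> b) \<otimes>\<^bsub>A\<^esub> c = a \<otimes>\<^bsub>A\<^esub> c \<ominus>\<^bsub>A\<^esub> c \<oplus>\<^bsub>A\<^esub> b \<otimes>\<^bsub>A\<^esub> c"
    if abc: "a \<in> carrier A" "b \<in> carrier A" "c \<in> carrier A" for a b c
  proof -
    let ?x = "(a \<oplus>\<^bsub>A\<^esub> b) \<otimes>\<^bsub>A\<^esub> c"
    have x: "?x \<in> carrier A" "a \<otimes>\<^bsub>A\<^esub> c \<in> carrier A" "b \<otimes>\<^bsub>A\<^esub> c \<in> carrier A"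
      using abc add by auto
    have "right_distributor A a b c = \<zero>\<^bsub>A\<^esub> \<longleftrightarrow> ?x \<ominus>\<^bsub>A\<^esub> b \<otimes>\<^bsub>A\<^esub> c \<oplus>\<^bsub>A\<^esub> c = a \<otimes>\<^bsub>A\<^esub> c"
      unfolding right_distributor_def using x abc by (intro minus_zero add minus)
    also have "\<dots> \<longleftrightarrow> ?x \<ominus>\<^bsub>A\<^esub> b \<otimes>\<^bsub>A\<^esub> c = a \<otimes>\<^bsub>A\<^esub> c \<ominus>\<^bsub>A\<^esub> c"
      using minus_eq[of "a \<otimes>\<^bsub>A\<^esub> c" c "?x \<ominus>\<^bsub>A\<^esub> b \<otimes>\<^bsub>A\<^esub> c"] x abc minus by metis
    also have "\<dots> \<longleftrightarrow> ?x = a \<otimes>\<^bsub>A\<^esub> c \<ominus>\<^bsub>A\<^esub> c \<oplus>\<^bsub>A\<^esub> b \<otimes>\<^bsub>A\<^esub> c"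
      using x abc by (intro minus_eq minus)
    finally show ?thesis .
  qed
  have S: "?S \<subseteq> {\<zero>\<^bsub>A\<^esub>} \<longleftrightarrow>
    (\<forall>a\<in>carrier A. \<forall>b\<in>carrier A. \<forall>c\<in>carrier A. right_distributor A a b c = \<zero>\<^bsub>A\<^esub>) \<and>
    (\<forall>a\<in>carrier A. \<forall>b\<in>carrier A. a \<oplus>\<^bsub>A\<^esub> b \<ominus>\<^bsub>A\<^esub> a \<ominus>\<^bsub>A\<^esub> b = \<zero>\<^bsub>A\<^esub>)"
    by blast
  show ?thesis
    unfolding R S in_RadRng_def using assms comm dist by auto
qed

end

(* Write D_c(x) = x o c - c, so that [a,b,c] = D_c(a+b) - D_c(b) - D_c(a), and evaluate the
   distributors of A x_B A on triples such as ((z,0),(b,b),(c,c)) with z in Ker(f): since a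
   distributor with a zero entry vanishes, centrality of f forces Ker(f) into Z_R(A).
   Conversely, two elements with the same image differ by some k in Ker(f), and for k in Z_R(A)
   the distributors and commutators do not change when one entry is shifted by k.  In the first
   two entries this holds because D_c(k) is additively central: it commutes with every D_c(x),
   and D_c is onto.  In the third entry D_{k+c}(x) = (lambda_x(k) - k) + D_c(x), where lambda_x
   is an automorphism of (A,+), so the correction term is central, and it is additive in x
   because [x,y,k] = 0. *)

theory Submission
  imports Defs
begin

section \<open>Generated subgroups: equality of homomorphisms and triviality are tested on
  generators\<close>

lemma (in group) generate_hom_eq:
  assumes S: "S \<subseteq> carrier G" and H: "group H" and g: "g \<in> hom G H" and h: "h \<in> hom G H"
    and eq: "\<And>x. x \<in> S \<Longrightarrow> g x = h x"
    and x: "x \<in> generate G S"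
  shows "g x = h x"
proof -
  interpret g: group_hom G H g using H g by (simp add: group_hom_def group_hom_axioms_def group_axioms)
  interpret h: group_hom G H h using H h by (simp add: group_hom_def group_hom_axioms_def group_axioms)
  from x show ?thesis
  proof induction
    case (inv y)
    then have "y \<in> carrier G" using S by blast
    with inv show ?case using eq by simp
  next
    case (eng y z)
    then have "y \<in> carrier G" "z \<in> carrier G" using generate_in_carrier[OF S] by blast+
    with eng show ?case by simp
  qed (use eq in auto)
qed

lemma (in group) generate_eq_one_iff:
  "generate G S = {\<one>} \<longleftrightarrow> S \<subseteq> {\<one>}"
proof
  assume "generate G S = {\<one>}"
  then show "S \<subseteq> {\<one>}" using generate.incl[of _ S G] by blast
next
  assume "S \<subseteq> {\<one>}"
  then show "generate G S = {\<one>}"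
    using generate_subgroup_incl[OF _ triv_subgroup] generate.one[of G S] by blast
qed

section \<open>Arithmetic in the two groups of a skew brace\<close>

context skew_brace
begin

text \<open>The rewrites state the facts of the additive group in the notation of the brace, so that
  they combine directly with those of the circle group.\<close>

sublocale add: group "add_monoid A"
  rewrites "carrier (add_monoid A) = carrier A"
    and "monoid.mult (add_monoid A) = (\<oplus>)"
    and "one (add_monoid A) = \<zero>"
    and "m_inv (add_monoid A) = a_inv A"
  by (rule add_group) (simp_all add: a_inv_def fun_eq_iff)

sublocale circ: group A
  by (rule circ_group)

lemma zero_circ [simp]: "a \<in> carrier A \<Longrightarrow> \<zero> \<otimes> a = a"
  using circ.l_one one_eq_zero by simp

lemma circ_zero [simp]: "a \<in> carrier A \<Longrightarrow> a \<otimes> \<zero> = a"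
  using circ.r_one one_eq_zero by simp

lemma minus_closed [simp]: "a \<in> carrier A \<Longrightarrow> b \<in> carrier A \<Longrightarrow> a \<ominus> b \<in> carrier A"
  by (simp add: a_minus_def)

text \<open>These complete right-nested associativity and the inverse laws to a rewriting system for
  groups; with \<open>add_group_simps\<close> they settle identities in the noncommutative sum by
  normalisation.\<close>

lemma add_neg_cancel [simp]:
  assumes "a \<in> carrier A" "b \<in> carrier A"
  shows "a \<oplus> (\<ominus> a \<oplus> b) = b" and "\<ominus> a \<oplus> (a \<oplus> b) = b"
  using assms by (simp_all flip: add.m_assoc)

lemmas add_group_simps = a_minus_def add.m_assoc add.inv_mult_group

lemma additive_commutator_eq_zero_iff:
  assumes "a \<in> carrier A" "b \<in> carrier A"
  shows "a \<oplus> b \<ominus> a \<ominus> b = \<zero> \<longleftrightarrow> a \<oplus> b = b \<oplus> a"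
  using assms add.inv_solve_right'[of "b" "a \<oplus> b" a] add.inv_solve_right'[of \<zero> "a \<oplus> b \<ominus> a" b]
  by (auto simp: a_minus_def)

section \<open>Right distributors as the additivity defect of D_c\<close>

lemma right_distributor_closed [simp]:
  assumes "a \<in> carrier A" "b \<in> carrier A" "c \<in> carrier A"
  shows "right_distributor A a b c \<in> carrier A"
  using assms by (simp add: right_distributor_def)

lemma right_distributor_zero [simp]:
  assumes "a \<in> carrier A" "b \<in> carrier A"
  shows "right_distributor A \<zero> a b = \<zero>" "right_distributor A a \<zero> b = \<zero>"
    "right_distributor A a b \<zero> = \<zero>"
  using assms by (simp_all add: right_distributor_def add_group_simps)

text \<open>The inner pair -c + c cancels. In this form a distributor is built from three values of
  D_c, which can be shifted separately.\<close>

lemma right_distributor_eq: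
  assumes "a \<in> carrier A" "b \<in> carrier A" "c \<in> carrier A"
  shows "right_distributor A a b c = ((a \<oplus> b) \<otimes> c \<ominus> c) \<ominus> (b \<otimes> c \<ominus> c) \<ominus> (a \<otimes> c \<ominus> c)"
  using assms by (simp add: right_distributor_def add_group_simps)

lemma right_distributor_eq_zeroD:
  assumes "a \<in> carrier A" "b \<in> carrier A" "c \<in> carrier A" "right_distributor A a b c = \<zero>"
  shows "(a \<oplus> b) \<otimes> c \<ominus> c = (a \<otimes> c \<ominus> c) \<oplus> (b \<otimes> c \<ominus> c)"
proof -
  let ?p = "(a \<oplus> b) \<otimes> c \<ominus> c" and ?q = "a \<otimes> c \<ominus> c" and ?r = "b \<otimes> c \<ominus> c"
  \<comment> \<open>The two subtractions are undone one at a time, from the right. Each time only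
    the outermost one is unfolded, so that \<open>inv_solve_right'\<close> applies and the order of
    the summands is kept.\<close>
  have "?p \<ominus> ?r = ?q"
    using assms add.inv_solve_right'[of \<zero> "?p \<ominus> ?r" ?q]
    by (simp add: right_distributor_eq a_minus_def[of A "?p \<ominus> ?r"])
  then show ?thesis
    using assms add.inv_solve_right'[of ?q ?p ?r] by (simp add: a_minus_def[of A ?p])
qed

section \<open>The center of the additive group and the maps that respect it\<close>

lemma additive_centerD:
  assumes "z \<in> additive_center A"
  shows "z \<in> carrier A" and "a \<in> carrier A \<Longrightarrow> a \<oplus> z = z \<oplus> a"
  using assms by (auto simp: additive_center_def)

lemma additive_center_left_commute:
  assumes "z \<in> additive_center A" "a \<in> carrier A" "b \<in> carrier A"
  shows "a \<oplus> (z \<oplus> b) = z \<oplus> (a \<oplus> b)"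
  using assms additive_centerD[OF assms(1)] by (simp flip: add.m_assoc)

lemma additive_center_neg:
  assumes "z \<in> additive_center A"
  shows "\<ominus> z \<in> additive_center A"
proof -
  have "\<ominus> z \<oplus> a = a \<oplus> \<ominus> z" if "a \<in> carrier A" for a
  proof -
    have "\<ominus> z \<oplus> a = \<ominus> z \<oplus> (a \<oplus> z) \<oplus> \<ominus> z"
      using additive_centerD(1)[OF assms] that by (simp add: add.m_assoc)
    also have "\<dots> = a \<oplus> \<ominus> z"
      using additive_centerD[OF assms] that by simp
    finally show ?thesis .
  qed
  then show ?thesis using additive_centerD(1)[OF assms] by (simp add: additive_center_def)
qed

lemma additive_center_add:
  assumes "y \<in> additive_center A" "z \<in> additive_center A"
  shows "y \<oplus> z \<in> additive_center A"
proof -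
  have "(y \<oplus> z) \<oplus> a = a \<oplus> (y \<oplus> z)" if "a \<in> carrier A" for a
    using assms[THEN additive_centerD(1)] that additive_centerD(2)[OF assms(2) that]
      additive_center_left_commute[OF assms(1) that, of z]
    by (simp add: add.m_assoc)
  then show ?thesis using assms[THEN additive_centerD(1)] by (simp add: additive_center_def)
qed

text \<open>D_c is right translation by c in the circle group followed by additive translation by
  -c, both bijective. Centrality can therefore be tested against values of D_c alone.\<close>

lemma circ_minus_surj:
  assumes "c \<in> carrier A" "y \<in> carrier A"
  obtains x where "x \<in> carrier A" "x \<otimes> c \<ominus> c = y"
proof
  show "(y \<oplus> c) \<otimes> inv c \<in> carrier A" "((y \<oplus> c) \<otimes> inv c) \<otimes> c \<ominus> c = y"
    using assms by (simp_all add: circ.m_assoc add_group_simps)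
qed

text \<open>This is the brace law read as additivity of lambda_x(a) = -x + x o a.\<close>

lemma lambda_add:
  assumes "x \<in> carrier A" "a \<in> carrier A" "b \<in> carrier A"
  shows "\<ominus> x \<oplus> x \<otimes> (a \<oplus> b) = (\<ominus> x \<oplus> x \<otimes> a) \<oplus> (\<ominus> x \<oplus> x \<otimes> b)"
  using assms by (simp add: brace_law add_group_simps)

text \<open>A surjective endomorphism maps the center into the center.\<close>

lemma lambda_additive_center:
  assumes x: "x \<in> carrier A" and z: "z \<in> additive_center A"
  shows "\<ominus> x \<oplus> x \<otimes> z \<in> additive_center A"
proof -
  have zA: "z \<in> carrier A" using z by (rule additive_centerD)
  have "(\<ominus> x \<oplus> x \<otimes> z) \<oplus> y = y \<oplus> (\<ominus> x \<oplus> x \<otimes> z)" if y: "y \<in> carrier A" for y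
  proof -
    \<comment> \<open>The witness solves lambda_x(w) = y by circle-multiplying x + y with the
      inverse of x.\<close>
    obtain w where w: "w \<in> carrier A" "\<ominus> x \<oplus> x \<otimes> w = y"
    proof
      show "inv x \<otimes> (x \<oplus> y) \<in> carrier A" "\<ominus> x \<oplus> x \<otimes> (inv x \<otimes> (x \<oplus> y)) = y"
        using x y by (simp_all flip: circ.m_assoc)
    qed
    show ?thesis
      using lambda_add[OF x zA w(1)] lambda_add[OF x w(1) zA] additive_centerD(2)[OF z w(1)] w(2)
      by simp
  qed
  then show ?thesis using x zA by (simp add: additive_center_def)
qed

section \<open>Invariance of distributors and commutators under shifts by \<open>Z_R\<close>\<close>

lemma Z_RD:
  assumes "z \<in> Z_R A"
  shows "z \<in> additive_center A" and "z \<in> carrier A"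
    and "\<lbrakk>b \<in> carrier A; c \<in> carrier A\<rbrakk> \<Longrightarrow> right_distributor A z b c = \<zero>"
    and "\<lbrakk>b \<in> carrier A; c \<in> carrier A\<rbrakk> \<Longrightarrow> right_distributor A b z c = \<zero>"
    and "\<lbrakk>b \<in> carrier A; c \<in> carrier A\<rbrakk> \<Longrightarrow> right_distributor A b c z = \<zero>"
  using assms by (auto simp: Z_R_def additive_center_def)

text \<open>Since [z,x,c] and [x,z,c] vanish, D_c(z + x) and D_c(x + z) split into the two sums of
  D_c(z) and D_c(x) in opposite orders; they agree because z is central.\<close>

lemma Z_R_circ_minus_center:
  assumes z: "z \<in> Z_R A" and c: "c \<in> carrier A"
  shows "z \<otimes> c \<ominus> c \<in> additive_center A"
proof -
  note zA = Z_RD(2)[OF z]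
  have "(z \<otimes> c \<ominus> c) \<oplus> y = y \<oplus> (z \<otimes> c \<ominus> c)" if y: "y \<in> carrier A" for y
  proof -
    obtain x where x: "x \<in> carrier A" "x \<otimes> c \<ominus> c = y" using circ_minus_surj[OF c y] .
    show ?thesis
      using right_distributor_eq_zeroD[OF zA x(1) c Z_RD(3)[OF z x(1) c]]
        right_distributor_eq_zeroD[OF x(1) zA c Z_RD(4)[OF z x(1) c]]
        additive_centerD(2)[OF Z_RD(1)[OF z] x(1)] x(2)
      by simp
  qed
  then show ?thesis using zA c by (simp add: additive_center_def)
qed

text \<open>The two patterns match \<open>right_distributor_eq\<close>: shifting the first entry
  changes the first and last terms, shifting the second entry changes the first two.\<close>

lemma center_shift_minus:
  assumes z: "z \<in> additive_center A"
    and p: "p \<in> carrier A" and q: "q \<in> carrier A" and r: "r \<in> carrier A"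
  shows "(z \<oplus> p) \<ominus> q \<ominus> (z \<oplus> r) = p \<ominus> q \<ominus> r"
    and "(z \<oplus> p) \<ominus> (z \<oplus> q) \<ominus> r = p \<ominus> q \<ominus> r"
  using p q r additive_centerD(1)[OF z] additive_centerD(2)[OF additive_center_neg[OF z]]
    additive_center_left_commute[OF additive_center_neg[OF z]]
  by (simp_all add: add_group_simps)

lemma additive_commutator_center_shift:
  assumes z: "z \<in> additive_center A" and a: "a \<in> carrier A" and b: "b \<in> carrier A"
  shows "(z \<oplus> a) \<oplus> b \<ominus> (z \<oplus> a) \<ominus> b = a \<oplus> b \<ominus> a \<ominus> b"
    and "a \<oplus> (z \<oplus> b) \<ominus> a \<ominus> (z \<oplus> b) = a \<oplus> b \<ominus> a \<ominus> b"
  using a b additive_centerD(1)[OF z] center_shift_minus(2)[OF z, of "a \<oplus> b" a b]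
    center_shift_minus(1)[OF z, of "a \<oplus> b" a b] additive_center_left_commute[OF z a b]
  by (simp_all add: add.m_assoc)

text \<open>Both D_c(z + (a + b)) and D_c(z + a) split off the central term D_c(z), and the two
  copies cancel.\<close>

lemma right_distributor_Z_R_shift_1:
  assumes z: "z \<in> Z_R A" and a: "a \<in> carrier A" and b: "b \<in> carrier A" and c: "c \<in> carrier A"
  shows "right_distributor A (z \<oplus> a) b c = right_distributor A a b c"
  using a b c Z_RD(2)[OF z] right_distributor_eq_zeroD[OF Z_RD(2)[OF z] _ c Z_RD(3)[OF z _ c]]
  by (simp add: right_distributor_eq add.m_assoc
      center_shift_minus(1)[OF Z_R_circ_minus_center[OF z c]])

text \<open>Centrality of z first rewrites a + (z + b) as z + (a + b); the splitting of D_c then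
  works as for the first entry.\<close>

lemma right_distributor_Z_R_shift_2:
  assumes z: "z \<in> Z_R A" and a: "a \<in> carrier A" and b: "b \<in> carrier A" and c: "c \<in> carrier A"
  shows "right_distributor A a (z \<oplus> b) c = right_distributor A a b c"
  using a b c Z_RD(2)[OF z] right_distributor_eq_zeroD[OF Z_RD(2)[OF z] _ c Z_RD(3)[OF z _ c]]
  by (simp add: right_distributor_eq additive_center_left_commute[OF Z_RD(1)[OF z]]
      center_shift_minus(2)[OF Z_R_circ_minus_center[OF z c]])

lemma right_distributor_Z_R_shift_3:
  assumes z: "z \<in> Z_R A" and a: "a \<in> carrier A" and b: "b \<in> carrier A" and c: "c \<in> carrier A"
  shows "right_distributor A a b (z \<oplus> c) = right_distributor A a b c"
proof -
  note zA = Z_RD(2)[OF z] and zc = Z_RD(1)[OF z]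
  note ncc = additive_center_neg[OF zc]
  \<comment> \<open>\<open>e x\<close> is the correction lambda_x(z) - z, by which D at z + c
    differs from D at c.\<close>
  define e where "e x = (\<ominus> x \<oplus> x \<otimes> z) \<ominus> z" for x
  have e_center: "e x \<in> additive_center A" if "x \<in> carrier A" for x
    unfolding e_def a_minus_def
    using that by (intro additive_center_add lambda_additive_center ncc zc)
  note eA = additive_centerD(1)[OF e_center]
  have D_z: "x \<otimes> z \<ominus> z = x \<oplus> e x" if "x \<in> carrier A" for x
    using that zA by (simp add: e_def add_group_simps)
  \<comment> \<open>As [x,y,z] = 0, D_z is additive; writing D_z(x) = x + \<open>e x\<close> and
    moving the central terms aside leaves additivity of \<open>e\<close> after cancelling x +
    y.\<close>
  have e_add: "e (x \<oplus> y) = e x \<oplus> e y" if x: "x \<in> carrier A" and y: "y \<in> carrier A" for x y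
  proof -
    have "(x \<oplus> y) \<oplus> e (x \<oplus> y) = (x \<oplus> e x) \<oplus> (y \<oplus> e y)"
      using right_distributor_eq_zeroD[OF x y zA Z_RD(5)[OF z x y]] D_z x y by simp
    also have "\<dots> = (x \<oplus> y) \<oplus> (e x \<oplus> e y)"
      using x y eA additive_center_left_commute[OF e_center[OF x], of y "e y"]
      by (simp add: add.m_assoc)
    finally show ?thesis using x y eA by simp
  qed
  have D_shift: "x \<otimes> (z \<oplus> c) \<ominus> (z \<oplus> c) = e x \<oplus> (x \<otimes> c \<ominus> c)" if x: "x \<in> carrier A" for x
  proof -
    \<comment> \<open>The left side is lambda_x(z) conjugated by x, and lambda_x(z) is
      central.\<close>
    have "x \<otimes> z \<ominus> x = \<ominus> x \<oplus> x \<otimes> z"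
    proof -
      have "x \<otimes> z \<ominus> x = x \<oplus> (\<ominus> x \<oplus> x \<otimes> z) \<oplus> \<ominus> x"
        using x zA by (simp add: add_group_simps)
      also have "\<dots> = (\<ominus> x \<oplus> x \<otimes> z) \<oplus> x \<oplus> \<ominus> x"
        using additive_centerD(2)[OF lambda_additive_center[OF x zc] x] by simp
      also have "\<dots> = \<ominus> x \<oplus> x \<otimes> z"
        using x zA by (simp add: add.m_assoc)
      finally show ?thesis .
    qed
    then have "x \<otimes> (z \<oplus> c) \<ominus> (z \<oplus> c) = (\<ominus> x \<oplus> x \<otimes> z) \<oplus> (x \<otimes> c \<oplus> (\<ominus> c \<oplus> \<ominus> z))"
      using x zA c by (simp add: brace_law add_group_simps)
    also have "\<dots> = e x \<oplus> (x \<otimes> c \<ominus> c)"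
      using x zA c additive_centerD(2)[OF ncc] additive_center_left_commute[OF ncc]
      by (simp add: e_def add_group_simps)
    finally show ?thesis .
  qed
  \<comment> \<open>Additivity splits \<open>e (a + b)\<close> into \<open>e a\<close>, which
    cancels against the last term, and \<open>e b\<close>, which cancels against the middle
    one.\<close>
  have "right_distributor A a b (z \<oplus> c) =
      (e a \<oplus> (e b \<oplus> ((a \<oplus> b) \<otimes> c \<ominus> c))) \<ominus> (e b \<oplus> (b \<otimes> c \<ominus> c)) \<ominus> (e a \<oplus> (a \<otimes> c \<ominus> c))"
    using a b c zA eA by (simp add: right_distributor_eq D_shift e_add add.m_assoc)
  also have "\<dots> = right_distributor A a b c"
    using a b c eA
    by (simp add: right_distributor_eq center_shift_minus[OF e_center])
  finally show ?thesis .
qed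

lemma RadRng_commutator_eq_zero_iff:
  assumes I: "I \<subseteq> carrier A"
  shows "RadRng_commutator A I = {\<zero>} \<longleftrightarrow> I \<subseteq> Z_R A"
proof -
  have "RadRng_commutator A I = {\<zero>} \<longleftrightarrow>
    (\<forall>a\<in>I. \<forall>b\<in>carrier A. \<forall>c\<in>carrier A.
      right_distributor A a b c = \<zero> \<and> right_distributor A c a b = \<zero> \<and>
      right_distributor A b c a = \<zero> \<and> a \<oplus> b \<ominus> a \<ominus> b = \<zero>)"
    unfolding RadRng_commutator_def add.generate_eq_one_iff by blast
  also have "\<dots> \<longleftrightarrow> I \<subseteq> Z_R A"
    \<comment> \<open>The commutator condition does not mention c; the element 0 instantiates that
      quantifier.\<close>
    using I add.one_closed
    by (auto simp: Z_R_def additive_center_def additive_commutator_eq_zero_iff subset_iff)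
  finally show ?thesis .
qed

end

section \<open>Homomorphisms and centrality read off the components of the kernel pair\<close>

lemma skew_brace_hom_compat:
  assumes "skew_brace A" "skew_brace B" "h \<in> skew_brace_hom A B"
    and abc: "a \<in> carrier A" "b \<in> carrier A" "c \<in> carrier A"
  shows "h (right_distributor A a b c) = right_distributor B (h a) (h b) (h c)"
    and "h (a \<oplus>\<^bsub>A\<^esub> b \<ominus>\<^bsub>A\<^esub> a \<ominus>\<^bsub>A\<^esub> b) = h a \<oplus>\<^bsub>B\<^esub> h b \<ominus>\<^bsub>B\<^esub> h a \<ominus>\<^bsub>B\<^esub> h b"
    and "h (a \<ominus>\<^bsub>A\<^esub> b) = h a \<ominus>\<^bsub>B\<^esub> h b"
proof -
  interpret A: skew_brace A by fact
  interpret B: skew_brace B by fact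
  interpret p: group_hom "add_monoid A" "add_monoid B" h
    using assms(3) A.add_group B.add_group
    by (simp add: group_hom_def group_hom_axioms_def skew_brace_hom_def)
  have plus: "h (x \<oplus>\<^bsub>A\<^esub> y) = h x \<oplus>\<^bsub>B\<^esub> h y" if "x \<in> carrier A" "y \<in> carrier A" for x y
    using p.hom_mult that by simp
  have minus: "h (x \<ominus>\<^bsub>A\<^esub> y) = h x \<ominus>\<^bsub>B\<^esub> h y" if "x \<in> carrier A" "y \<in> carrier A" for x y
    using p.hom_inv[of y] that by (simp add: a_minus_def plus a_inv_def[symmetric])
  have circ: "h (x \<otimes>\<^bsub>A\<^esub> y) = h x \<otimes>\<^bsub>B\<^esub> h y" if "x \<in> carrier A" "y \<in> carrier A" for x y
    using assms(3) that by (simp add: skew_brace_hom_def hom_def)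
  show "h (right_distributor A a b c) = right_distributor B (h a) (h b) (h c)"
    "h (a \<oplus>\<^bsub>A\<^esub> b \<ominus>\<^bsub>A\<^esub> a \<ominus>\<^bsub>A\<^esub> b) = h a \<oplus>\<^bsub>B\<^esub> h b \<ominus>\<^bsub>B\<^esub> h a \<ominus>\<^bsub>B\<^esub> h b"
    "h (a \<ominus>\<^bsub>A\<^esub> b) = h a \<ominus>\<^bsub>B\<^esub> h b"
    using abc by (simp_all add: right_distributor_def plus minus circ)
qed

text \<open>The projections are homomorphisms, so they agree on R of the kernel pair once they agree
  on its generators, whose components are distributors and commutators in A.\<close>

lemma RadRng_central_iff:
  assumes "skew_brace_extension A B f"
  shows "RadRng_central A B f \<longleftrightarrow>
    (\<forall>x\<in>carrier (kernel_pair A f). \<forall>y\<in>carrier (kernel_pair A f). \<forall>w\<in>carrier (kernel_pair A f).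
      right_distributor A (fst x) (fst y) (fst w) = right_distributor A (snd x) (snd y) (snd w) \<and>
      fst x \<oplus>\<^bsub>A\<^esub> fst y \<ominus>\<^bsub>A\<^esub> fst x \<ominus>\<^bsub>A\<^esub> fst y = snd x \<oplus>\<^bsub>A\<^esub> snd y \<ominus>\<^bsub>A\<^esub> snd x \<ominus>\<^bsub>A\<^esub> snd y)"
    (is "_ \<longleftrightarrow> (\<forall>x\<in>carrier ?K. \<forall>y\<in>_. \<forall>w\<in>_. ?P x y w)")
proof -
  interpret A: skew_brace A using assms by (simp add: skew_brace_extension_def)
  interpret K: skew_brace ?K by (rule kernel_pair_skew_brace(1)[OF assms])
  note homs = kernel_pair_skew_brace(2,3)[OF assms]
  note hom_eqs = skew_brace_hom_compat(1,2)[OF K.skew_brace_axioms A.skew_brace_axioms]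
  let ?S = "\<Union>a\<in>carrier ?K. \<Union>b\<in>carrier ?K. \<Union>c\<in>carrier ?K.
      {right_distributor ?K a b c, right_distributor ?K c a b, right_distributor ?K b c a,
       a \<oplus>\<^bsub>?K\<^esub> b \<ominus>\<^bsub>?K\<^esub> a \<ominus>\<^bsub>?K\<^esub> b}"
  have S: "?S \<subseteq> carrier ?K" by auto
  \<comment> \<open>Outside R both restrictions are \<open>undefined\<close>, so equality of the
    functions means agreement on the generated subgroup.\<close>
  have "RadRng_central A B f \<longleftrightarrow> (\<forall>x\<in>generate (add_monoid ?K) ?S. fst x = snd x)"
    using assms
    by (auto simp: RadRng_central_def R_mor_def R_obj_def RadRng_commutator_def fun_eq_iff
        restrict_def)
  also have "\<dots> \<longleftrightarrow> (\<forall>x\<in>?S. fst x = snd x)"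
  proof
    show "\<forall>x\<in>?S. fst x = snd x" if "\<forall>x\<in>generate (add_monoid ?K) ?S. fst x = snd x"
      using that generate.incl[of _ ?S "add_monoid ?K"] by blast
    show "\<forall>x\<in>generate (add_monoid ?K) ?S. fst x = snd x" if "\<forall>x\<in>?S. fst x = snd x"
      using K.add.generate_hom_eq[OF S A.add_group, of fst snd] that homs
      unfolding skew_brace_hom_def by blast
  qed
  \<comment> \<open>All three entries range over the whole kernel pair, so the three permuted
    distributor families coincide.\<close>
  also have "\<dots> \<longleftrightarrow> (\<forall>x\<in>carrier ?K. \<forall>y\<in>carrier ?K. \<forall>w\<in>carrier ?K. ?P x y w)"
    by (simp add: hom_eqs homs ball_UN) blast
  finally show ?thesis .
qed

theorem theorem4p13:
  fixes A :: "('a, 'm) ring_scheme" and B :: "('b, 'n) ring_scheme" and f :: "'a \<Rightarrow> 'b"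
  assumes "skew_brace_extension A B f"
  shows "(RadRng_central A B f \<longleftrightarrow> a_kernel A B f \<subseteq> Z_R A) \<and>
    (a_kernel A B f \<subseteq> Z_R A \<longleftrightarrow> RadRng_commutator A (a_kernel A B f) = {\<zero>\<^bsub>A\<^esub>})"
proof -
  interpret A: skew_brace A using assms by (simp add: skew_brace_extension_def)
  interpret B: skew_brace B using assms by (simp add: skew_brace_extension_def)
  have f: "f \<in> skew_brace_hom A B" using assms by (simp add: skew_brace_extension_def)
  let ?K = "kernel_pair A f" and ?N = "a_kernel A B f"
  have N: "x \<in> ?N \<longleftrightarrow> x \<in> carrier A \<and> f x = \<zero>\<^bsub>B\<^esub>" for x
    by (simp add: a_kernel_def kernel_def)
  have K: "(x, y) \<in> carrier ?K \<longleftrightarrow> x \<in> carrier A \<and> y \<in> carrier A \<and> f x = f y" for x y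
    by (simp add: kernel_pair_def)
  have f_zero: "f \<zero>\<^bsub>A\<^esub> = \<zero>\<^bsub>B\<^esub>"
    using f hom_one[of f "add_monoid A" "add_monoid B"] A.add_group B.add_group
    by (simp add: skew_brace_hom_def)
  have "RadRng_central A B f \<longleftrightarrow> ?N \<subseteq> Z_R A"
  proof
    assume "RadRng_central A B f"
    then have eq: "right_distributor A x y w = right_distributor A x' y' w'"
        "x \<oplus>\<^bsub>A\<^esub> y \<ominus>\<^bsub>A\<^esub> x \<ominus>\<^bsub>A\<^esub> y = x' \<oplus>\<^bsub>A\<^esub> y' \<ominus>\<^bsub>A\<^esub> x' \<ominus>\<^bsub>A\<^esub> y'"
      if "(x, x') \<in> carrier ?K" "(y, y') \<in> carrier ?K" "(w, w') \<in> carrier ?K" for x x' y y' w w'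
      using that unfolding RadRng_central_iff[OF assms] by fastforce+
    show "?N \<subseteq> Z_R A"
    proof
      fix z assume z: "z \<in> ?N"
      then have zA: "z \<in> carrier A" and zK: "(z, \<zero>\<^bsub>A\<^esub>) \<in> carrier ?K"
        by (simp_all add: N K f_zero)
      have diag: "(b, b) \<in> carrier ?K" if "b \<in> carrier A" for b
        using that by (simp add: K)
      \<comment> \<open>The second component is the commutator of 0 and b, which vanishes; the third
        pair is a filler.\<close>
      have "z \<oplus>\<^bsub>A\<^esub> b = b \<oplus>\<^bsub>A\<^esub> z" if "b \<in> carrier A" for b
        using eq(2)[OF zK diag diag, of b b] that zA A.additive_commutator_eq_zero_iff[of z b]
          A.additive_commutator_eq_zero_iff[of "\<zero>\<^bsub>A\<^esub>" b]
        by simp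
      \<comment> \<open>Putting (z, 0) in each slot gives the three distributor conditions, the
        second component having a zero entry every time.\<close>
      then show "z \<in> Z_R A"
        using eq(1)[OF zK diag diag] eq(1)[OF diag zK diag] eq(1)[OF diag diag zK] zA
        by (simp add: Z_R_def additive_center_def)
    qed
  next
    assume NZ: "?N \<subseteq> Z_R A"
    \<comment> \<open>The witness is x - x', subtracted on the right so that the shift stands on the
      left, as in the shift lemmas.\<close>
    have split: "\<exists>k\<in>Z_R A. x = k \<oplus>\<^bsub>A\<^esub> x'" if "(x, x') \<in> carrier ?K" for x x'
    proof
      have x: "x \<in> carrier A" "x' \<in> carrier A" "f x = f x'" using that by (simp_all add: K)
      then have "f x' \<in> carrier B" using f by (auto simp: skew_brace_hom_def hom_def)
      then have "f (x \<ominus>\<^bsub>A\<^esub> x') = \<zero>\<^bsub>B\<^esub>"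
        using skew_brace_hom_compat(3)[OF A.skew_brace_axioms B.skew_brace_axioms f x(1,2) x(1)]
          x(3) by (simp add: a_minus_def)
      then show "x \<ominus>\<^bsub>A\<^esub> x' \<in> Z_R A" using NZ N x by auto
      show "x = x \<ominus>\<^bsub>A\<^esub> x' \<oplus>\<^bsub>A\<^esub> x'" using x by (simp add: a_minus_def A.add.m_assoc)
    qed
    show "RadRng_central A B f"
      unfolding RadRng_central_iff[OF assms]
    proof (intro ballI, goal_cases)
      case (1 p q r)
      obtain x x' y y' w w' where pqr: "p = (x, x')" "q = (y, y')" "r = (w, w')"
        by (cases p; cases q; cases r)
      obtain i j k where ijk: "i \<in> Z_R A" "j \<in> Z_R A" "k \<in> Z_R A"
        and eqs: "x = i \<oplus>\<^bsub>A\<^esub> x'" "y = j \<oplus>\<^bsub>A\<^esub> y'" "w = k \<oplus>\<^bsub>A\<^esub> w'"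
        using split 1 pqr by metis
      have carr: "x' \<in> carrier A" "y' \<in> carrier A" "w' \<in> carrier A"
        using 1 pqr by (simp_all add: K)
      \<comment> \<open>The shifts i, j and k are removed entry by entry, which turns the first
        components into the second ones.\<close>
      show ?case
        using carr ijk[THEN A.Z_RD(2)]
        by (simp add: pqr eqs A.right_distributor_Z_R_shift_1[OF ijk(1)]
            A.right_distributor_Z_R_shift_2[OF ijk(2)] A.right_distributor_Z_R_shift_3[OF ijk(3)]
            A.additive_commutator_center_shift(1)[OF A.Z_RD(1)[OF ijk(1)]]
            A.additive_commutator_center_shift(2)[OF A.Z_RD(1)[OF ijk(2)]])
    qed
  qed
  moreover have "RadRng_commutator A ?N = {\<zero>\<^bsub>A\<^esub>} \<longleftrightarrow> ?N \<subseteq> Z_R A"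
    by (rule A.RadRng_commutator_eq_zero_iff) (auto simp: N)
  ultimately show ?thesis by blast
qed

end
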